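(* Let $u\in\mathcal{F}_0$, $v\in\mathcal{F}_1$, and let $t_{n,k}=[x^n]u(x)v(x)^k$ be the $(n,k)$-element of the Riordan array $(u,v)$. Then for all $n\ge k\ge 0$ $$t_{n,k}=[x^{n-k}]\,g(x)f(x)^n,$$ where $$f(x)=\frac{x}{\operatorname{Rev}(v)(x)}\quad\text{and}\quad g(x)=f(x)\,\frac{u\left(\operatorname{Rev}(v)(x)\right)}{v'\left(\operatorname{Rev}(v)(x)\right)}.$$
   Context: All power series are formal power series in $x$ with coefficients in $\mathbb{Q}$. $\mathcal{F}_0$ is the set of series $a_0+a_1x+a_2x^2+\cdots$ with $a_0\neq 0$; $\mathcal{F}_1$ is the set of series $a_1x+a_2x^2+\cdots$ with $a_1\ne 0$. $[x^m]$ extracts the coefficient of $x^m$. For $v\in\mathcal{F}_1$, $\operatorname{Rev}(v)\in\mathcal{F}_1$ denotes its compositional inverse, and $v'$ its formal derivative. The quotient $x/w$ for $w\in\mathcal{F}_1$ is understood as a power series after cancelling the factor $x$. The Riordan array $(u,v)$ is the infinite lower-triangular matrix, indexed by $n,k\ge0$, with $(n,k)$ entry $[x^n]\,u(x)v(x)^k$. *)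

theory Defs
  imports "HOL-Computational_Algebra.Formal_Power_Series"
begin

definition F0 :: "rat fps set" where
  "F0 = {a. fps_nth a 0 \<noteq> 0}"

definition F1 :: "rat fps set" where
  "F1 = {a. fps_nth a 0 = 0 \<and> fps_nth a 1 \<noteq> 0}"

definition riordan_array :: "rat fps \<Rightarrow> rat fps \<Rightarrow> nat \<Rightarrow> nat \<Rightarrow> rat" where
  "riordan_array u v n k = fps_nth (u * v ^ k) n"

text \<open>
  For \<open>v \<in> F1\<close>, \<^const>\<open>fps_inv\<close> is the two-sided compositional inverse, as the following
  lemma records.
\<close>

lemma fps_inv_F1:
  assumes "v \<in> F1"
  shows "fps_inv v oo v = fps_X" and "v oo fps_inv v = fps_X" and "fps_inv v \<in> F1"
proof -
  have v: "fps_nth v 0 = 0" "fps_nth v 1 \<noteq> 0"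
    using assms by (auto simp: F1_def)
  show "fps_inv v oo v = fps_X"
    using v by (rule fps_inv)
  show "v oo fps_inv v = fps_X"
    using v by (rule fps_inv_right)
  show "fps_inv v \<in> F1"
    using v by (simp add: F1_def fps_inv_def)
qed

text \<open>
  Division on \<^typ>\<open>rat fps\<close> strips the leading power of \<^const>\<open>fps_X\<close> from the
  denominator, so \<open>fps_X / w\<close> for \<open>w \<in> F1\<close> is the power series obtained by cancelling
  a factor \<^const>\<open>fps_X\<close>.
\<close>

lemma fps_X_divide_F1:
  assumes "w \<in> F1"
  shows "(fps_X / w) * w = fps_X" and "fps_X / w \<in> F0"
proof -
  have sd: "subdegree w = 1"
    using assms by (intro subdegreeI) (auto simp: F1_def)
  have "w \<noteq> 0"
    using sd by auto
  then have "w dvd fps_X"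
    using sd by (simp add: fps_dvd_iff)
  then show *: "(fps_X / w) * w = fps_X"
    by simp
  have "fps_nth ((fps_X / w) * w) 1 = 1"
    by (simp only: *) simp
  then show "fps_X / w \<in> F0"
    using assms by (auto simp: F0_def F1_def fps_mult_nth)
qed

end

(*
  With w = Rev v we have f w = x, and 1 / (v' o w) = w' by the chain rule, so after
  multiplying by x^k the claim reads [x^n] f^(n+1) (h o w) w' = [x^n] h for h = u v^k.
  By linearity it suffices to take h = x^j, where it becomes [x^m] f^(m+1) w' = [m = 0]
  with m = n - j.  Differentiating f w = x gives f w' = 1 - f' w, hence for m > 0
  f^(m+1) w' = f^m - x (f^m)' / m, and the x^m coefficient of the right-hand side vanishes.
*)

theory Submission
  imports Defs
begin

text \<open>Linearity in \<open>h\<close>: as \<open>w\<close> has no constant term,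
  \<open>w ^ j\<close> starts in degree at least \<open>j\<close>, so only \<open>j \<le> n\<close>
  contribute.\<close>

lemma fps_nth_mult_compose:
  fixes a h w :: "'a::idom fps"
  assumes "fps_nth w 0 = 0"
  shows "fps_nth (a * (h oo w)) n = (\<Sum>j\<le>n. fps_nth h j * fps_nth (a * w ^ j) n)"
proof -
  \<comment> \<open>The bound \<open>n\<close> in place of \<open>i\<close> adds only zero terms and
    makes the range of \<open>j\<close> independent of \<open>i\<close>, so the sums can be
    swapped.\<close>
  have *: "fps_nth (h oo w) i = (\<Sum>j\<le>n. fps_nth h j * fps_nth (w ^ j) i)" if "i \<le> n" for i
    unfolding fps_compose_nth using that assms
    by (intro sum.mono_neutral_left) (auto intro: startsby_zero_power_prefix[rule_format])
  have mult: "fps_nth (a * b) n = (\<Sum>i\<le>n. fps_nth a (n - i) * fps_nth b i)" for b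
    by (subst mult.commute, unfold fps_mult_nth atLeast0AtMost)
       (simp add: mult.commute)
  have "fps_nth (a * (h oo w)) n
      = (\<Sum>i\<le>n. \<Sum>j\<le>n. fps_nth a (n - i) * (fps_nth h j * fps_nth (w ^ j) i))"
    by (simp add: mult * sum_distrib_left)
  also have "\<dots> = (\<Sum>j\<le>n. \<Sum>i\<le>n. fps_nth a (n - i) * (fps_nth h j * fps_nth (w ^ j) i))"
    by (rule sum.swap)
  also have "\<dots> = (\<Sum>j\<le>n. fps_nth h j * fps_nth (a * w ^ j) n)"
    by (simp add: mult sum_distrib_left mult_ac)
  finally show ?thesis .
qed

text \<open>As \<open>f = x/w\<close>, this coefficient is the residue of \<open>w'/w^(m+1)\<close>,
  an exact derivative unless \<open>m = 0\<close>. The proof avoids Laurent series.\<close>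

lemma fps_nth_power_mult_deriv:
  fixes f w :: "'a::field_char_0 fps"
  assumes fw: "f * w = fps_X" and w0: "fps_nth w 0 = 0"
  shows "fps_nth (f ^ Suc m * fps_deriv w) m = (if m = 0 then 1 else 0)"
proof -
  have "fps_deriv (f * w) = 1"
    using fw by simp
  then have d: "f * fps_deriv w = 1 - fps_deriv f * w"
    by (simp add: algebra_simps)
  have e: "f ^ Suc m * fps_deriv w = f ^ m - f ^ m * w * fps_deriv f"
  proof -
    have "f ^ Suc m * fps_deriv w = f ^ m * (f * fps_deriv w)"
      by (simp add: mult_ac)
    then show ?thesis
      by (simp add: d algebra_simps)
  qed
  show ?thesis
  proof (cases m)
    case 0
    then show ?thesis using d w0 by simp
  next
    case (Suc l)
    have "f ^ m * w = fps_X * f ^ l"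
      using fw Suc by (simp add: ac_simps)
    then have "f ^ Suc m * fps_deriv w = f ^ m - fps_X * (f ^ l * fps_deriv f)"
      by (simp only: e mult.assoc)
    \<comment> \<open>Both sides are the coefficient of degree \<open>l = m - 1\<close> in the
      derivative of \<open>f ^ m\<close>; \<open>of_nat m\<close> cancels in characteristic
      0.\<close>
    moreover have "of_nat m * fps_nth (f ^ l * fps_deriv f) l = of_nat m * fps_nth (f ^ m) m"
    proof -
      have "fps_deriv (f ^ m) = fps_const (of_nat m) * (f ^ l * fps_deriv f)"
        by (simp add: fps_deriv_power Suc mult_ac del: fps_deriv_nth of_nat_Suc power_Suc)
      then have "fps_nth (fps_deriv (f ^ m)) l = of_nat m * fps_nth (f ^ l * fps_deriv f) l"
        by (simp only: fps_mult_left_const_nth)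
      then show ?thesis
        by (simp add: Suc del: power_Suc of_nat_Suc fps_deriv_power)
    qed
    ultimately show ?thesis using Suc
      by (simp del: power_Suc of_nat_Suc)
  qed
qed

text \<open>Change of variables in a residue: substituting \<open>w\<close> turns
  \<open>h/x^(n+1)\<close> into \<open>(h oo w) w'/w^(n+1)\<close> and preserves the
  residue.\<close>

lemma fps_nth_power_mult_compose_deriv:
  fixes f w h :: "'a::field_char_0 fps"
  assumes fw: "f * w = fps_X" and w0: "fps_nth w 0 = 0"
  shows "fps_nth (f ^ Suc n * fps_deriv w * (h oo w)) n = fps_nth h n"
proof -
  have "fps_nth (f ^ Suc n * fps_deriv w * w ^ j) n = (if j = n then 1 else 0)"
    if "j \<le> n" for j
  proof -
    \<comment> \<open>The split-off \<open>f ^ j\<close> pairs with \<open>w ^ j\<close> to give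
      \<open>fps_X ^ j\<close>, leaving the previous lemma at \<open>m = n - j\<close>.\<close>
    have "f ^ Suc n = f ^ Suc (n - j) * f ^ j"
      using that by (simp flip: power_add)
    then have "f ^ Suc n * fps_deriv w * w ^ j = fps_X ^ j * (f ^ Suc (n - j) * fps_deriv w)"
      by (simp only: fw[symmetric] power_mult_distrib mult_ac)
    then show ?thesis
      using that fps_nth_power_mult_deriv[OF fw w0, of "n - j"]
      by (simp only: fps_X_power_mult_nth) auto
  qed
  then have "fps_nth (f ^ Suc n * fps_deriv w * (h oo w)) n
      = (\<Sum>j\<le>n. if j = n then fps_nth h j else 0)"
    by (simp only: fps_nth_mult_compose[OF w0]) (intro sum.cong; simp)
  then show ?thesis
    by simp
qed

theorem proposition6:
  fixes u v f g :: "rat fps" and n k :: nat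
  assumes "u \<in> F0" and "v \<in> F1"
    and "f = fps_X / fps_inv v"
    and "g = f * ((u oo fps_inv v) / (fps_deriv v oo fps_inv v))"
    and "k \<le> n"
  shows "riordan_array u v n k = fps_nth (g * f ^ n) (n - k)"
proof -
  define w where "w = fps_inv v"
  have w: "w \<in> F1" and vw: "v oo w = fps_X"
    using fps_inv_F1[OF assms(2)] by (simp_all add: w_def)
  have w0: "fps_nth w 0 = 0"
    using w by (simp add: F1_def)
  have fw: "f * w = fps_X"
    using fps_X_divide_F1(1)[OF w] by (simp add: assms(3) w_def)
  have chain: "(fps_deriv v oo w) * fps_deriv w = 1"
    using arg_cong[OF vw, of fps_deriv] by (simp add: fps_compose_deriv[OF w0])
  then have "fps_deriv v oo w \<noteq> 0"
    by auto
  moreover have "u oo w = (u oo w) * fps_deriv w * (fps_deriv v oo w)"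
    using chain by (simp add: ac_simps)
  ultimately have q: "(u oo w) / (fps_deriv v oo w) = (u oo w) * fps_deriv w"
    by (metis nonzero_mult_div_cancel_right)
  then have g: "g * f ^ n = f ^ Suc n * fps_deriv w * (u oo w)"
    by (simp add: assms(4) q mult_ac flip: w_def)
  \<comment> \<open>Composition with \<open>w\<close> turns \<open>v ^ k\<close> into
    \<open>fps_X ^ k\<close>, which accounts for the shift from \<open>n\<close> to
    \<open>n - k\<close>.\<close>
  have "(u * v ^ k) oo w = (u oo w) * fps_X ^ k"
    using w0 by (simp add: fps_compose_mult_distrib vw flip: fps_compose_power)
  then have "f ^ Suc n * fps_deriv w * ((u * v ^ k) oo w) = fps_X ^ k * (g * f ^ n)"
    by (simp only: g mult_ac)
  then have "fps_nth (u * v ^ k) n = fps_nth (fps_X ^ k * (g * f ^ n)) n"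
    using fps_nth_power_mult_compose_deriv[OF fw w0, of n "u * v ^ k"] by (simp only:)
  then show ?thesis
    using \<open>k \<le> n\<close> by (simp add: riordan_array_def fps_X_power_mult_nth)
qed

end
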